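(* Let $k\ge1$ and let $\mathcal A$ be a connected $\mathord{\leq}4$-splitting family on $k$ of minimum size (among all connected $\mathord{\leq}4$-splitting families on $k$). Then for $k$ even, $\mathcal A$ is equivalent to the standard splitting family on $k$, and for $k$ odd, $\mathcal A$ is equivalent to the standard splitting family on $k+1$ with the point $k+1$ removed (i.e. each set $A$ of it replaced by $A\cap[k]$). In particular, $|\mathcal A|=\lceil k/2\rceil$.
   Context: Let $[k]=\{1,\dots,k\}$. For $A,B\subseteq[k]$, $A$ splits $B$ if $|A\cap B|=|B|/2$ when $|B|$ is even, and $|A\cap B|\in\{(|B|-1)/2,(|B|+1)/2\}$ when $|B|$ is odd. A family $\mathcal A$ of subsets of $[k]$ is a $\mathord{\leq}t$-splitting family on $k$ if every $B\subseteq[k]$ with $|B|\le t$ is split by some $A\in\mathcal A$. For a $\mathord{\leq}2$-splitting family $\mathcal A=\{A_1,\dots,A_n\}$ on $k$, its incidence matrix is the $n\times k$ matrix with $(i,j)$ entry $1$ if $j\in A_i$ and $0$ otherwise; its columns are distinct elements of $\{0,1\}^n$. The Hamming representation of $\mathcal A$ is the graph whose vertex set $S\subseteq\{0,1\}^n$ is the set of columns, with $s\sim t$ if and only if $s,t$ differ in exactly one entry. $\mathcal A$ is connected if its Hamming representation is a connected graph. Families $\mathcal A,\mathcal A'$ of subsets of $[k]$ are equivalent if $\mathcal A'$ can be obtained from $\mathcal A$ by replacing some of the sets of $\mathcal A$ by their complements in $[k]$ and permuting the elements of $[k]$. For even $k$, the standard splitting family on $k$ consists of the sets $A_i=\{i,i+1,\dots,i+k/2-1\}$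 for $i=1,\dots,k/2$. *)

theory Defs
  imports
    Complex_Main
    "HOL-Library.FuncSet"
    "HOL-Combinatorics.Permutations"
    "Graph_Theory.Digraph_Component"
    "Graph_Theory.Pair_Digraph"
begin

definition splits :: "nat set \<Rightarrow> nat set \<Rightarrow> bool" where
  "splits A B \<longleftrightarrow>
     (if even (card B) then card (A \<inter> B) = card B div 2
      else card (A \<inter> B) \<in> {(card B - 1) div 2, (card B + 1) div 2})"

definition le_splitting_family :: "nat \<Rightarrow> nat \<Rightarrow> nat set set \<Rightarrow> bool" where
  "le_splitting_family t k \<A> \<longleftrightarrow>
     \<A> \<subseteq> Pow {1..k} \<and>
     (\<forall>B. B \<subseteq> {1..k} \<and> card B \<le> t \<longrightarrow> (\<exists>A\<in>\<A>. splits A B))"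

(* The rows of the incidence matrix are indexed by the members of the family themselves
   instead of by an enumeration A_1, ..., A_n of them, so a column is an element of
   {0,1}^\<A>, rendered as PiE \<A> (\<lambda>_. {0,1}). *)
definition incidence_matrix :: "nat set \<Rightarrow> nat \<Rightarrow> nat" where
  "incidence_matrix A j = (if j \<in> A then 1 else 0)"

definition incidence_column :: "nat set set \<Rightarrow> nat \<Rightarrow> (nat set \<Rightarrow> nat)" where
  "incidence_column \<A> j = (\<lambda>A\<in>\<A>. incidence_matrix A j)"

(* The undirected edge between s and t is represented by the two arcs (s,t) and (t,s). *)
definition hamming_representation ::
    "nat \<Rightarrow> nat set set \<Rightarrow> (nat set \<Rightarrow> nat) pair_pre_digraph" where
  "hamming_representation k \<A> =
     (let S = incidence_column \<A> ` {1..k} in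
      \<lparr> pverts = S,
        parcs = {(s, t). s \<in> S \<and> t \<in> S \<and> card {A \<in> \<A>. s A \<noteq> t A} = 1} \<rparr>)"

definition connected_family :: "nat \<Rightarrow> nat set set \<Rightarrow> bool" where
  "connected_family k \<A> \<longleftrightarrow>
     Digraph_Component.connected (with_proj (hamming_representation k \<A>))"

(* \<C> is the collection of those members of \<A> that are replaced by their complements. *)
definition equivalent_families :: "nat \<Rightarrow> nat set set \<Rightarrow> nat set set \<Rightarrow> bool" where
  "equivalent_families k \<A> \<A>' \<longleftrightarrow>
     (\<exists>\<C> \<pi>. \<C> \<subseteq> \<A> \<and> \<pi> permutes {1..k} \<and>
        \<A>' = (\<lambda>A. \<pi> ` (if A \<in> \<C> then {1..k} - A else A)) ` \<A>)"

(* Only meant for even k. *)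
definition standard_splitting_family :: "nat \<Rightarrow> nat set set" where
  "standard_splitting_family k = (\<lambda>i. {i..i + k div 2 - 1}) ` {1..k div 2}"

end

theory Submission
  imports Defs
begin

text \<open>
  Let the family have \<open>n\<close> members. Distinct points have distinct columns because pairs are split,
  and splitting a set of four distinct points means that some coordinate cuts it into two pairs
  (\<open>four_points\<close>). A vertex with three neighbours in the Hamming representation contradicts this
  (\<open>no_claw\<close>), so a connected representation has a path through all \<open>k\<close> vertices
  (\<open>hamiltonian_path_if_claw_free\<close>).

  Label every edge of the path with the member of the family in which its ends differ. The
  four-point condition controls repetitions of labels: when, after distinct labels
  \<open>a 0, \<dots>, a (m - 1)\<close>, a label occurs again, it has to be \<open>a 0\<close>, and from then on the sequence has
  period \<open>m\<close> (\<open>labels_periodic\<close>). After \<open>2 * m\<close> edges every one of these coordinates would have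
  changed twice and the path would have returned to its start, so it has fewer edges. Hence
  \<open>k \<le> 2 * m \<le> 2 * n\<close>.

  The standard family, with one point removed for odd \<open>k\<close>, is connected and splits every set
  (\<open>standard_splits\<close>, \<open>standard_connected\<close>), so a smallest family has \<open>n \<le> (k + 1) div 2\<close>. The
  inequalities above then give \<open>m = n = (k + 1) div 2\<close>. For \<open>k > 1\<close> every member of the family
  labels an edge, and its value changes exactly after the path positions \<open>s\<close> and \<open>s + n\<close> for its index \<open>s\<close>, as far as
  these exist. Numbering the points along the path turns it into a standard window or the
  complement of one (\<open>equivalent_standard\<close>).
\<close>

section \<open>Sets separating two points\<close>

text \<open>
  The set of coordinates in which the columns of \<open>p\<close> and \<open>q\<close> differ. Splitting conditions and
  adjacency depend on a family only through these sets, so everything below is stated on the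
  points themselves instead of on columns.
\<close>
definition separators :: "'a set set \<Rightarrow> 'a \<Rightarrow> 'a \<Rightarrow> 'a set set" where
  "separators \<A> p q = {A \<in> \<A>. (p \<in> A) \<noteq> (q \<in> A)}"

lemma separators_self [simp]: "separators \<A> p p = {}"
  by (simp add: separators_def)

lemma separators_commute: "separators \<A> p q = separators \<A> q p"
  by (auto simp: separators_def)

lemma separators_sym_diff:
  "separators \<A> p r = sym_diff (separators \<A> p q) (separators \<A> q r)"
  by (auto simp: separators_def)

lemma separators_nonempty:
  assumes "le_splitting_family t k \<A>" "2 \<le> t" "p \<in> {1..k}" "q \<in> {1..k}" "p \<noteq> q"
  shows "separators \<A> p q \<noteq> {}"
proof -
  have "{p, q} \<subseteq> {1..k}" "card {p, q} = 2" using assms by auto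
  then obtain A where "A \<in> \<A>" "splits A {p, q}"
    using assms(1,2) unfolding le_splitting_family_def by metis
  moreover have "card (A \<inter> {p, q}) = 1"
    using \<open>splits A {p, q}\<close> \<open>card {p, q} = 2\<close> by (simp add: splits_def)
  ultimately have "A \<in> separators \<A> p q"
    using \<open>p \<noteq> q\<close>
    by (cases "p \<in> A"; cases "q \<in> A") (auto simp: separators_def Int_insert_right)
  then show ?thesis by blast
qed

lemma splits_four_points:
  assumes "splits A {p, q, r, s}" "distinct [p, q, r, s]"
  shows "card (A \<inter> {p, q, r, s}) = 2"
  using assms by (simp add: splits_def)

text \<open>
  A set splits \<open>{p, q, r, s}\<close> iff its incidence pattern on \<open>p, q, r, s\<close> is, up to complement,
  \<open>0011\<close>, \<open>0101\<close> or \<open>0110\<close>. In the last two patterns the set separates both \<open>p, q\<close> and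
  \<open>r, s\<close>; in the first it separates \<open>q, r\<close> only. Later arguments derive contradictions by
  violating both alternatives.
\<close>
lemma four_points:
  assumes "le_splitting_family 4 k \<A>" "{p, q, r, s} \<subseteq> {1..k}" "distinct [p, q, r, s]"
  shows "separators \<A> p q \<inter> separators \<A> r s \<noteq> {} \<or>
         \<not> separators \<A> q r \<subseteq> separators \<A> p q \<union> separators \<A> r s"
proof -
  have "card {p, q, r, s} = 4" using assms(3) by simp
  then obtain A where A: "A \<in> \<A>" "splits A {p, q, r, s}"
    using assms(1,2) unfolding le_splitting_family_def by (metis order_refl)
  then have "card (A \<inter> {p, q, r, s}) = 2"
    using assms(3) splits_four_points by blast
  then show ?thesis
    using A(1) assms(3)
    by (cases "p \<in> A"; cases "q \<in> A"; cases "r \<in> A"; cases "s \<in> A")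
       (auto simp: Int_insert_right separators_def)
qed

text \<open>
  In a claw every one of the three edge directions isolates one leaf from the other three
  vertices, and the other coordinates are constant on the claw, so no coordinate cuts the four points into two pairs. Hence all degrees in the
  Hamming representation are at most two.
\<close>
lemma no_claw:
  assumes fam: "le_splitting_family 4 k \<A>"
    and pts: "{v, p, q, r} \<subseteq> {1..k}" "distinct [v, p, q, r]"
    and nbr: "card (separators \<A> v p) = 1" "card (separators \<A> v q) = 1"
      "card (separators \<A> v r) = 1"
  shows False
proof -
  from nbr obtain A B C where
    sep: "separators \<A> v p = {A}" "separators \<A> v q = {B}" "separators \<A> v r = {C}"
    by (metis card_1_singletonE)
  have diff: "separators \<A> p q = sym_diff {A} {B}" "separators \<A> q r = sym_diff {B} {C}"
    "separators \<A> p r = sym_diff {A} {C}"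
    using sep separators_sym_diff separators_commute by metis+
  have "separators \<A> p q \<noteq> {}" "separators \<A> q r \<noteq> {}" "separators \<A> p r \<noteq> {}"
    using separators_nonempty[OF fam, of p q] separators_nonempty[OF fam, of q r]
      separators_nonempty[OF fam, of p r] pts by auto
  then have "A \<noteq> B" "B \<noteq> C" "A \<noteq> C" using diff by auto
  moreover have "separators \<A> p v = {A}" using sep separators_commute by metis
  ultimately show False
    using four_points[OF fam, of p v q r] pts sep diff by auto
qed

section \<open>Connectedness of the Hamming representation\<close>

lemma incidence_column_differ:
  "{A \<in> \<A>. incidence_column \<A> p A \<noteq> incidence_column \<A> q A} = separators \<A> p q"
  by (auto simp: incidence_column_def incidence_matrix_def separators_def)

text \<open>
  Adjacency in the Hamming representation is symmetric already, so the symmetric closure in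
  the definition of connectedness adds no arcs.
\<close>
lemma connected_family_iff_reachable:
  "connected_family k \<A> \<longleftrightarrow> k \<ge> 1 \<and>
     (\<forall>p\<in>{1..k}. \<forall>q\<in>{1..k}. (incidence_column \<A> p, incidence_column \<A> q) \<in>
        rtrancl_on (incidence_column \<A> ` {1..k}) (parcs (hamming_representation k \<A>)))"
proof -
  let ?H = "hamming_representation k \<A>"
  have "(s, t) \<in> parcs ?H \<longleftrightarrow> (t, s) \<in> parcs ?H" for s t
  proof -
    have "{A \<in> \<A>. s A \<noteq> t A} = {A \<in> \<A>. t A \<noteq> s A}" by auto
    then show ?thesis by (auto simp: hamming_representation_def Let_def)
  qed
  then have "parcs (mk_symmetric (with_proj ?H)) = parcs ?H"
    by (auto simp: parcs_mk_symmetric)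
  moreover have "pverts ?H = incidence_column \<A> ` {1..k}"
    by (simp add: hamming_representation_def Let_def)
  ultimately show ?thesis
    unfolding connected_family_def Digraph_Component.connected_def strongly_connected_def
      reachable_def
    by (auto simp: Suc_le_eq)
qed

lemma parcs_hamming_representation_iff:
  assumes "p \<in> {1..k}" "q \<in> {1..k}"
  shows "(incidence_column \<A> p, incidence_column \<A> q) \<in> parcs (hamming_representation k \<A>)
           \<longleftrightarrow> card (separators \<A> p q) = 1"
  using assms incidence_column_differ[of \<A> p q] by (simp add: hamming_representation_def Let_def)

text \<open>
  Cut form of connectedness. The hypothesis that distinct points are separated makes columns
  injective, which lets a walk between columns be read as a walk between points.
\<close>
lemma connected_family_crossing_edge:
  assumes conn: "connected_family k \<A>"
    and inj: "\<And>p q. p \<in> {1..k} \<Longrightarrow> q \<in> {1..k} \<Longrightarrow> p \<noteq> q \<Longrightarrow> separators \<A> p q \<noteq> {}"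
    and U: "U \<noteq> {}" "U \<subset> {1..k}"
  shows "\<exists>u\<in>U. \<exists>v\<in>{1..k} - U. card (separators \<A> u v) = 1"
proof (rule ccontr)
  assume no_edge: "\<not> ?thesis"
  let ?c = "incidence_column \<A>"
  obtain p q where p: "p \<in> U" and q: "q \<in> {1..k}" "q \<notin> U" using U by blast
  then have "(?c p, ?c q) \<in> rtrancl_on (?c ` {1..k}) (parcs (hamming_representation k \<A>))"
    using conn U unfolding connected_family_iff_reachable by blast
  then have "?c q \<in> ?c ` U"
  proof (induction rule: rtrancl_on_induct)
    case base
    then show ?case using p by blast
  next
    case (step s t)
    then obtain u v where "u \<in> U" "s = ?c u" "v \<in> {1..k}" "t = ?c v" by blast
    moreover from this have "card (separators \<A> u v) = 1"
      using step.hyps(2) U parcs_hamming_representation_iff[of u k v \<A>] by blast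
    ultimately show ?case using no_edge by blast
  qed
  then obtain u where "u \<in> U" "?c u = ?c q" by force
  then have "separators \<A> u q = {}"
    using incidence_column_differ[of \<A> u q] by auto
  then show False using inj[of u q] U q \<open>u \<in> U\<close> by blast
qed

lemma connected_family_if_consecutive:
  assumes "k \<ge> 1" and step: "\<And>i. 1 \<le> i \<Longrightarrow> i < k \<Longrightarrow> card (separators \<A> i (Suc i)) = 1"
  shows "connected_family k \<A>"
proof -
  let ?c = "incidence_column \<A>"
  let ?R = "rtrancl_on (?c ` {1..k}) (parcs (hamming_representation k \<A>))"
  have up: "1 \<le> p \<Longrightarrow> p \<le> k \<Longrightarrow> (?c 1, ?c p) \<in> ?R \<and> (?c p, ?c 1) \<in> ?R" for p
  proof (induction p rule: dec_induct)
    case base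
    then show ?case by auto
  next
    case (step p)
    have "card (separators \<A> p (Suc p)) = 1" using assms(2) step by simp
    then have "(?c p, ?c (Suc p)) \<in> parcs (hamming_representation k \<A>)"
      "(?c (Suc p), ?c p) \<in> parcs (hamming_representation k \<A>)"
      using parcs_hamming_representation_iff[of p k "Suc p" \<A>]
        parcs_hamming_representation_iff[of "Suc p" k p \<A>] step separators_commute[of \<A> p "Suc p"]
      by auto
    moreover have "?c (Suc p) \<in> ?c ` {1..k}" using step by simp
    ultimately show ?case
      using step rtrancl_on_into_rtrancl_on converse_rtrancl_on_into_rtrancl_on
      by (metis Suc_leD)
  qed
  then show ?thesis
    unfolding connected_family_iff_reachable using \<open>k \<ge> 1\<close>
    by (meson atLeastAtMost_iff rtrancl_on_trans)
qed

section \<open>Hamiltonian paths\<close>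

lemma successively_nthD:
  "successively P xs \<Longrightarrow> Suc i < length xs \<Longrightarrow> P (xs ! i) (xs ! Suc i)"
proof (induction P xs arbitrary: i rule: successively.induct)
  case (3 P x y xs)
  then show ?case by (cases i) auto
qed auto

text \<open>
  A longest path covers all vertices: an edge leaving the path at an endpoint would extend it,
  and one leaving it at an inner vertex would make that vertex the centre of a claw. The claw
  here need not be induced, so the hypothesis says that degrees are at most two. In a cycle
  the path omits one edge.
\<close>
lemma hamiltonian_path_if_claw_free:
  assumes V: "finite V" "V \<noteq> {}"
    and sym: "\<And>u v. R u v \<Longrightarrow> R v u"
    and claw_free: "\<And>v p q r. {v, p, q, r} \<subseteq> V \<Longrightarrow> distinct [v, p, q, r] \<Longrightarrow>
      R v p \<Longrightarrow> R v q \<Longrightarrow> R v r \<Longrightarrow> False"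
    and crossing: "\<And>U. U \<noteq> {} \<Longrightarrow> U \<subset> V \<Longrightarrow> \<exists>u\<in>U. \<exists>v\<in>V - U. R u v"
  obtains xs where "distinct xs" "set xs = V" "successively R xs"
proof -
  define path where
    "path xs \<longleftrightarrow> xs \<noteq> [] \<and> distinct xs \<and> set xs \<subseteq> V \<and> successively R xs" for xs
  obtain w where "w \<in> V" using V by blast
  then have "path [w]" by (simp add: path_def)
  moreover have "length xs < Suc (card V)" if "path xs" for xs
    using that card_mono[OF V(1), of "set xs"] by (simp add: path_def distinct_card)
  ultimately obtain xs where xs: "path xs" and longest: "\<And>ys. path ys \<Longrightarrow> length ys \<le> length xs"
    using ex_has_greatest_nat[of path "[w]" length "Suc (card V)"] by blast
  have "set xs = V"
  proof (rule ccontr)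
    assume "set xs \<noteq> V"
    then obtain u v where uv: "u \<in> set xs" "v \<in> V" "v \<notin> set xs" "R u v"
      using crossing[of "set xs"] xs by (auto simp: path_def)
    then obtain i where i: "i < length xs" "u = xs ! i" by (metis in_set_conv_nth)
    have "i \<noteq> 0"
    proof
      assume "i = 0"
      then have "path (v # xs)"
        using xs uv i sym by (auto simp: path_def successively_Cons hd_conv_nth)
      then show False using longest by fastforce
    qed
    moreover have "Suc i \<noteq> length xs"
    proof
      assume "Suc i = length xs"
      then have "u = last xs" using i xs by (auto simp: path_def last_conv_nth simp flip: \<open>Suc i = _\<close>)
      then have "path (xs @ [v])"
        using xs uv by (auto simp: path_def successively_append_iff)
      then show False using longest by fastforce
    qed
    ultimately obtain j where j: "i = Suc j" "Suc i < length xs"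
      using i by (cases i) auto
    have "R u (xs ! j)" "R u (xs ! Suc i)"
      using successively_nthD[of R xs j] successively_nthD[of R xs i] xs i j sym
      by (auto simp: path_def)
    moreover have "distinct [u, xs ! j, xs ! Suc i, v]"
    proof -
      have "xs ! j \<noteq> xs ! i" "xs ! Suc i \<noteq> xs ! i" "xs ! j \<noteq> xs ! Suc i"
        using xs i j by (auto simp: path_def nth_eq_iff_index_eq)
      moreover have "v \<noteq> xs ! j" "v \<noteq> xs ! i" "v \<noteq> xs ! Suc i"
        using uv(3) j i nth_mem[of j xs] nth_mem[of i xs] nth_mem[of "Suc i" xs] by auto
      ultimately show ?thesis using i by auto
    qed
    moreover have "{u, xs ! j, xs ! Suc i, v} \<subseteq> V"
    proof -
      have "xs ! j \<in> set xs" "xs ! Suc i \<in> set xs" using j by auto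
      then show ?thesis using uv xs by (auto simp: path_def)
    qed
    ultimately show False using claw_free \<open>R u v\<close> by blast
  qed
  then show thesis using that xs by (auto simp: path_def)
qed

section \<open>Edge labels along a path in the Hamming representation\<close>

text \<open>
  A path \<open>x 0, \<dots>, x e\<close> with \<open>e\<close> edges, where \<open>a i\<close> is the only member of the family that separates
  the ends of the edge from \<open>x i\<close> to \<open>x (Suc i)\<close>. The last assumption is the four-point condition for
  points taken in path order.
\<close>
locale labelled_path =
  fixes \<A> :: "'a set set" and x :: "nat \<Rightarrow> 'a" and a :: "nat \<Rightarrow> 'a set" and e :: nat
  assumes label: "\<And>i. i < e \<Longrightarrow> separators \<A> (x i) (x (Suc i)) = {a i}"
    and separated: "\<And>i j. i < j \<Longrightarrow> j \<le> e \<Longrightarrow> separators \<A> (x i) (x j) \<noteq> {}"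
    and four: "\<And>i j l m. i < j \<Longrightarrow> j < l \<Longrightarrow> l < m \<Longrightarrow> m \<le> e \<Longrightarrow>
      separators \<A> (x i) (x j) \<inter> separators \<A> (x l) (x m) \<noteq> {} \<or>
      \<not> separators \<A> (x j) (x l) \<subseteq> separators \<A> (x i) (x j) \<union> separators \<A> (x l) (x m)"
begin

text \<open>
  A set separates two path points iff it labels an odd number of the edges between them;
  for distinct labels this number is at most one.
\<close>
lemma separators_eq_labels:
  assumes "i \<le> j" "j \<le> e" "inj_on a {i..<j}"
  shows "separators \<A> (x i) (x j) = a ` {i..<j}"
  using assms
proof (induction j rule: dec_induct)
  case base
  then show ?case by simp
next
  case (step j)
  have split: "{i..<Suc j} = insert j {i..<j}" using step.hyps by auto
  then have "a j \<notin> a ` {i..<j}" "inj_on a {i..<j}" using step.prems by (auto simp: inj_on_insert)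
  then have "separators \<A> (x i) (x j) = a ` {i..<j}" using step by simp
  moreover have "separators \<A> (x j) (x (Suc j)) = {a j}" using label step.prems by simp
  ultimately show ?case
    using separators_sym_diff[of \<A> "x i" "x (Suc j)" "x j"] \<open>a j \<notin> a ` {i..<j}\<close> split by auto
qed

text \<open>
  If a run of distinct labels is followed by one of them, it is the first one. Otherwise, for
  the label \<open>a l\<close> with \<open>i < l\<close>, the points \<open>x i, x l, x (Suc l), x (Suc j)\<close> violate the four-point
  condition: the middle pair is separated only by \<open>a l\<close>, which also occurs as \<open>a j\<close> between the
  last two points, and the outer pairs have no separating label in common.
\<close>
lemma repeated_label_is_first:
  assumes inj: "inj_on a {i..<j}" and j: "j < e" and l: "i \<le> l" "l < j" "a j = a l"
  shows "l = i"
proof (rule ccontr)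
  assume "l \<noteq> i"
  then have "i < l" using l by simp
  have "inj_on a {Suc l..<j}" using inj l by (auto intro: inj_on_subset)
  moreover have "a l \<notin> a ` {Suc l..<j}"
    by (subst inj_on_image_mem_iff[OF inj]) (use l in auto)
  moreover have Suc_j: "{Suc l..<Suc j} = insert j {Suc l..<j}" using l by auto
  ultimately have "inj_on a {Suc l..<Suc j}" using l(3) by simp
  then have D3: "separators \<A> (x (Suc l)) (x (Suc j)) = a ` {Suc l..<Suc j}"
    using separators_eq_labels l j by simp
  have D1: "separators \<A> (x i) (x l) = a ` {i..<l}"
    using separators_eq_labels[of i l] \<open>i < l\<close> l j inj inj_on_subset[OF inj, of "{i..<l}"] by force
  have D2: "separators \<A> (x l) (x (Suc l)) = {a l}" using label l j by simp
  have "a s \<noteq> a t" if "s \<in> {i..<l}" "t \<in> {Suc l..<Suc j}" for s t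
  proof (cases "t = j")
    case True
    moreover have "s \<in> {i..<j}" "l \<in> {i..<j}" "s \<noteq> l" using that l by auto
    ultimately show ?thesis using inj_onD[OF inj, of s l] l(3) by auto
  next
    case False
    then have "s \<in> {i..<j}" "t \<in> {i..<j}" "s \<noteq> t" using that l by auto
    then show ?thesis using inj_onD[OF inj, of s t] by blast
  qed
  then have "a ` {i..<l} \<inter> a ` {Suc l..<Suc j} = {}" by blast
  moreover have "a l \<in> a ` {Suc l..<Suc j}" unfolding Suc_j using l(3) by auto
  ultimately show False
    using four[of i l "Suc l" "Suc j"] \<open>i < l\<close> l j D1 D2 D3 by simp
qed

text \<open>
  After a run of distinct labels has begun to repeat, the next label cannot be new: otherwise
  \<open>x i, x j, x (Suc j), x (Suc (Suc j))\<close> violate the four-point condition, since the label \<open>a i\<close>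
  separating the middle pair already separates the first. Being old, it is the first label of the
  run shifted by one.
\<close>
lemma next_label_repeats:
  assumes inj: "inj_on a {i..<j}" and "i < j" "Suc j < e" and "a j = a i"
  shows "a (Suc j) = a (Suc i)"
proof -
  have old: "a (Suc j) \<in> a ` {i..<j}"
  proof (rule ccontr)
    assume "a (Suc j) \<notin> a ` {i..<j}"
    moreover have "separators \<A> (x i) (x j) = a ` {i..<j}"
      using separators_eq_labels assms by simp
    moreover have "separators \<A> (x j) (x (Suc j)) = {a i}"
      "separators \<A> (x (Suc j)) (x (Suc (Suc j))) = {a (Suc j)}"
      using label assms by auto
    ultimately show False using four[of i j "Suc j" "Suc (Suc j)"] assms by auto
  qed
  have shift: "{i..<j} = insert i {Suc i..<j}" "{Suc i..<Suc j} = insert j {Suc i..<j}"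
    using \<open>i < j\<close> by auto
  have img: "a ` {Suc i..<Suc j} = a ` {i..<j}" unfolding shift using \<open>a j = a i\<close> by simp
  have inj': "inj_on a {Suc i..<Suc j}"
    using inj \<open>a j = a i\<close> unfolding shift by auto
  obtain l where "Suc i \<le> l" "l < Suc j" "a (Suc j) = a l"
    using old img by (metis (no_types, lifting) atLeastLessThan_iff imageE)
  then show ?thesis using repeated_label_is_first[OF inj'] assms by blast
qed

lemma labels_periodic_from_first_repetition:
  assumes inj: "inj_on a {..<m}" and "0 < m" "a m = a 0" "m + t < e"
  shows "inj_on a {t..<m + t} \<and> a (m + t) = a t"
  using \<open>m + t < e\<close>
proof (induction t)
  case 0
  then show ?case using inj \<open>a m = a 0\<close> by (simp add: atLeast0LessThan)
next
  case (Suc t)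
  then have IH: "inj_on a {t..<m + t}" "a (m + t) = a t" by auto
  have shift: "{t..<m + t} = insert t {Suc t..<m + t}"
    "{Suc t..<m + Suc t} = insert (m + t) {Suc t..<m + t}"
    using \<open>0 < m\<close> by auto
  have "inj_on a {Suc t..<m + Suc t}" using IH unfolding shift by auto
  then show ?case using next_label_repeats[of t "m + t"] IH Suc.prems \<open>0 < m\<close> by auto
qed

text \<open>
  If no label repeats, the period is the number of edges and periodicity is vacuous.
\<close>
lemma labels_periodic:
  assumes "0 < e"
  obtains m where "0 < m" "inj_on a {..<m}" "\<And>t. m + t < e \<Longrightarrow> a (m + t) = a t"
proof (cases "inj_on a {..<e}")
  case True
  then show thesis using that[of e] assms by simp
next
  case False
  define j where "j = (LEAST j. \<not> inj_on a {..<j})"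
  have not_inj: "\<not> inj_on a {..<j}" unfolding j_def using False by (rule LeastI)
  then obtain m where m: "j = Suc m" by (cases j) auto
  then have inj: "inj_on a {..<m}" using not_less_Least[of m "\<lambda>j. \<not> inj_on a {..<j}"] j_def by auto
  have "j \<le> e" unfolding j_def using False by (rule Least_le)
  have "a m \<in> a ` {..<m}" using not_inj inj m by (auto simp: lessThan_Suc)
  then obtain l where l: "l < m" "a m = a l" by auto
  then have "l = 0"
    using repeated_label_is_first[of 0 m l] inj \<open>j \<le> e\<close> m by (simp add: atLeast0LessThan)
  then have "\<And>t. m + t < e \<Longrightarrow> a (m + t) = a t"
    using labels_periodic_from_first_repetition[OF inj] l by auto
  then show thesis using that[of m] l inj \<open>j \<le> e\<close> m by simp
qed

text \<open>
  Going along one period collects the labels one after the other, and going along the second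
  removes them in the same order; so \<open>a s\<close> separates \<open>x 0\<close> from \<open>x j\<close> exactly for
  \<open>s < j \<le> s + m\<close>.
\<close>
lemma separators_from_start:
  assumes inj: "inj_on a {..<m}" and per: "\<And>t. m + t < e \<Longrightarrow> a (m + t) = a t"
    and j: "j \<le> e" "j \<le> 2 * m"
  shows "separators \<A> (x 0) (x j) = a ` {s. s < m \<and> s < j \<and> j \<le> s + m}"
proof (cases "j \<le> m")
  case True
  then have "separators \<A> (x 0) (x j) = a ` {0..<j}"
    using separators_eq_labels[of 0 j] j inj_on_subset[OF inj, of "{0..<j}"] by force
  moreover have "{s. s < m \<and> s < j \<and> j \<le> s + m} = {0..<j}" using True by auto
  ultimately show ?thesis by simp
next
  case False
  have "separators \<A> (x 0) (x (m + t)) = a ` {t..<m}" if "m + t \<le> e" "t \<le> m" for t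
    using that
  proof (induction t)
    case 0
    then show ?case using separators_eq_labels[of 0 m] inj by (simp add: atLeast0LessThan)
  next
    case (Suc t)
    then have IH: "separators \<A> (x 0) (x (m + t)) = a ` {t..<m}" by simp
    have "separators \<A> (x (m + t)) (x (Suc (m + t))) = {a t}"
      using label[of "m + t"] per[of t] Suc.prems by simp
    moreover have "{t..<m} = insert t {Suc t..<m}" using Suc.prems by auto
    moreover have "a t \<notin> a ` {Suc t..<m}"
      by (subst inj_on_image_mem_iff[OF inj]) (use Suc.prems in auto)
    ultimately show ?case
      using separators_sym_diff[of \<A> "x 0" "x (m + Suc t)" "x (m + t)"] IH by auto
  qed
  from this[of "j - m"] have "separators \<A> (x 0) (x j) = a ` {j - m..<m}" using False j by simp
  moreover have "{s. s < m \<and> s < j \<and> j \<le> s + m} = {j - m..<m}" using False j by auto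
  ultimately show ?thesis by simp
qed

text \<open>
  After two full periods the path would be back at its start.
\<close>
lemma length_less_double_period:
  assumes "inj_on a {..<m}" "\<And>t. m + t < e \<Longrightarrow> a (m + t) = a t" "0 < m"
  shows "e < 2 * m"
proof (rule ccontr)
  assume "\<not> e < 2 * m"
  then have "separators \<A> (x 0) (x (2 * m)) = a ` {s. s < m \<and> s < 2 * m \<and> 2 * m \<le> s + m}"
    using separators_from_start[OF assms(1,2), of "2 * m"] by simp
  also have "\<dots> = {}" by auto
  finally show False using separated[of 0 "2 * m"] \<open>0 < m\<close> \<open>\<not> e < 2 * m\<close> by auto
qed

end

section \<open>The standard splitting family\<close>

lemma standard_splitting_family_double:
  "standard_splitting_family (2 * n) = (\<lambda>i. {i..i + n - 1}) ` {1..n}"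
  by (simp add: standard_splitting_family_def)

lemma inj_on_windows: "inj_on (\<lambda>i. {i..i + n - 1}) {1..n::nat}"
  by (rule inj_onI) (auto simp: Icc_eq_Icc)

lemma card_standard_splitting_family: "card (standard_splitting_family (2 * n)) = n"
  unfolding standard_splitting_family_double using card_image[OF inj_on_windows] by simp

text \<open>
  The windows split sets of every size. Moving a window of length \<open>n\<close> by one step changes
  the number of points of \<open>B\<close> in it by at most one, and after \<open>n\<close> steps it has become the
  complement of the first window. By the discrete intermediate value theorem this number takes
  the value \<open>card B div 2\<close> on the way.
\<close>
lemma standard_splits:
  assumes B: "B \<subseteq> {1..2 * n}" and "1 \<le> n"
  obtains i where "i \<in> {1..n}" "splits {i..i + n - 1} B"
proof -
  have finB: "finite B" using B finite_subset by blast
  define W where "W i = {i..i + n - 1} \<inter> B" for i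
  define f where "f i = int (card (W i))" for i
  define h where "h = int (card B div 2)"
  have finW: "finite (W i)" for i using finB by (simp add: W_def)
  have step: "\<bar>f (Suc i) - f i\<bar> \<le> 1" for i
  proof -
    have "W (Suc i) \<subseteq> insert (i + n) (W i)" "W i \<subseteq> insert i (W (Suc i))"
      using \<open>1 \<le> n\<close> by (auto simp: W_def)
    then have "card (W (Suc i)) \<le> card (insert (i + n) (W i))"
      "card (W i) \<le> card (insert i (W (Suc i)))"
      using finW by (auto intro!: card_mono simp del: card_insert_disjoint)
    then have "card (W (Suc i)) \<le> Suc (card (W i))" "card (W i) \<le> Suc (card (W (Suc i)))"
      using finW by (auto simp: card_insert_if split: if_splits)
    then show ?thesis by (simp add: f_def)
  qed
  have opposite: "f (Suc n) = int (card B) - f 1"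
  proof -
    have "W 1 \<union> W (Suc n) = B" "W 1 \<inter> W (Suc n) = {}" using B by (auto simp: W_def)
    then have "card B = card (W 1) + card (W (Suc n))"
      using finW card_Un_disjoint by metis
    then show ?thesis by (simp add: f_def)
  qed
  have "\<exists>i. 1 \<le> i \<and> i \<le> Suc n \<and> f i = h"
  proof (cases "f 1 \<le> h")
    case True
    then have "h \<le> f (Suc n)" unfolding opposite h_def by linarith
    then show ?thesis
      using nat_intermed_int_val[of 1 "Suc n" f h] step True by auto
  next
    case False
    then have "- f 1 \<le> - h" "- h \<le> - f (Suc n)" unfolding opposite h_def by linarith+
    moreover have "\<bar>- f (Suc i) - - f i\<bar> \<le> 1" for i using step[of i] by linarith
    ultimately show ?thesis
      using nat_intermed_int_val[of 1 "Suc n" "\<lambda>i. - f i" "- h"] by auto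
  qed
  then obtain i where i: "1 \<le> i" "i \<le> Suc n" "f i = h" by blast
  have splits: "splits {j..j + n - 1} B" if "f j = h \<or> f j = int (card B) - h" for j
  proof -
    have "card ({j..j + n - 1} \<inter> B) = card B div 2 \<or>
          card ({j..j + n - 1} \<inter> B) = card B - card B div 2"
      using that unfolding f_def W_def h_def by linarith
    moreover have "even (card B) \<Longrightarrow> card B - card B div 2 = card B div 2"
      "odd (card B) \<Longrightarrow> card B div 2 = (card B - 1) div 2"
      "odd (card B) \<Longrightarrow> card B - card B div 2 = (card B + 1) div 2"
      by presburger+
    ultimately show ?thesis unfolding splits_def by fastforce
  qed
  \<comment> \<open>The window at \<open>Suc n\<close> is not in the family; its complement, the window at 1, is.\<close>
  show thesis
  proof (cases "i = Suc n")
    case True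
    then have "f 1 = int (card B) - h" using i opposite by simp
    then show thesis using that[of 1] splits[of 1] \<open>1 \<le> n\<close> by simp
  next
    case False
    then show thesis using that[of i] splits[of i] i by simp
  qed
qed

text \<open>
  For \<open>k = 2 * n - 1\<close> no window contains the point \<open>2 * n\<close>, so the family of windows is at the
  same time the standard family with that point removed. This allows even and odd \<open>k\<close> to be
  treated alike.
\<close>
lemma standard_le_splitting:
  assumes "1 \<le> n" "2 * n - 1 \<le> k" "k \<le> 2 * n"
  shows "le_splitting_family t k (standard_splitting_family (2 * n))"
  unfolding le_splitting_family_def standard_splitting_family_double
proof (intro conjI allI impI)
  show "(\<lambda>i. {i..i + n - 1}) ` {1..n} \<subseteq> Pow {1..k}" using assms by auto
next
  fix B assume "B \<subseteq> {1..k} \<and> card B \<le> t"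
  then have "B \<subseteq> {1..2 * n}" using assms by auto
  then show "\<exists>A\<in>(\<lambda>i. {i..i + n - 1}) ` {1..n}. splits A B"
    by (rule standard_splits[OF _ \<open>1 \<le> n\<close>]) blast
qed

lemma standard_connected:
  assumes "1 \<le> n" "1 \<le> k" "k \<le> 2 * n"
  shows "connected_family k (standard_splitting_family (2 * n))"
proof (rule connected_family_if_consecutive[OF \<open>1 \<le> k\<close>])
  fix j assume j: "1 \<le> j" "j < k"
  let ?w = "\<lambda>i. {i..i + n - 1}"
  define c where "c = (if j < n then Suc j else Suc j - n)"
  have "c \<in> {1..n}" using j assms by (auto simp: c_def)
  \<comment> \<open>For \<open>j < n\<close> a window starts at \<open>Suc j\<close>; otherwise one ends at \<open>j\<close>.\<close>
  have "(j \<in> ?w i) \<noteq> (Suc j \<in> ?w i) \<longleftrightarrow> i = c" if "i \<in> {1..n}" for i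
    using that j assms by (auto simp: c_def)
  then have "separators (standard_splitting_family (2 * n)) j (Suc j) = {?w c}"
    unfolding standard_splitting_family_double separators_def using \<open>c \<in> {1..n}\<close> by blast
  then show "card (separators (standard_splitting_family (2 * n)) j (Suc j)) = 1" by simp
qed

section \<open>Small connected families\<close>

text \<open>
  The condition that all values of \<open>a\<close> lie in the family, also beyond the last edge, matters
  when \<open>k = 1\<close>: then there is no edge, and \<open>a 0\<close> names the only set of a smallest family.
\<close>
lemma connected_splitting_path:
  assumes fam: "le_splitting_family 4 k \<A>" and conn: "connected_family k \<A>" and "1 \<le> k"
  obtains x a where "bij_betw x {..<k} {1..k}" "labelled_path \<A> x a (k - 1)" "range a \<subseteq> \<A>"
proof -
  let ?R = "\<lambda>p q. card (separators \<A> p q) = 1"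
  have sep: "separators \<A> p q \<noteq> {}" if "p \<in> {1..k}" "q \<in> {1..k}" "p \<noteq> q" for p q
    using separators_nonempty[OF fam] that by simp
  obtain xs where xs: "distinct xs" "set xs = {1..k}" "successively ?R xs"
  proof (rule hamiltonian_path_if_claw_free[of "{1..k}" ?R])
    show "finite {1..k}" "{1..k} \<noteq> {}" using \<open>1 \<le> k\<close> by auto
    show "?R v u" if "?R u v" for u v using that by (simp add: separators_commute)
    show False if "{v, p, q, r} \<subseteq> {1..k}" "distinct [v, p, q, r]" "?R v p" "?R v q" "?R v r"
      for v p q r using no_claw[OF fam] that by blast
    show "\<exists>u\<in>U. \<exists>v\<in>{1..k} - U. ?R u v" if "U \<noteq> {}" "U \<subset> {1..k}" for U
      using connected_family_crossing_edge[OF conn sep] that by blast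
  qed
  have len: "length xs = k" using distinct_card[OF xs(1)] xs(2) by simp
  define x where "x i = xs ! i" for i
  have bij: "bij_betw x {..<k} {1..k}"
    using bij_betw_nth[OF xs(1), of "{..<k}" "{1..k}"] len xs(2) unfolding x_def by simp
  obtain A0 where "A0 \<in> \<A>" using fam unfolding le_splitting_family_def
    by (metis card.empty empty_subsetI zero_le)
  define a where "a i = (if i < k - 1 then the_elem (separators \<A> (x i) (x (Suc i))) else A0)" for i
  have label: "separators \<A> (x i) (x (Suc i)) = {a i}" if "i < k - 1" for i
  proof -
    have "?R (x i) (x (Suc i))" unfolding x_def using successively_nthD[OF xs(3)] that len by simp
    then show ?thesis using that by (auto simp: a_def card_1_singleton_iff)
  qed
  have "a i \<in> \<A>" for i
  proof (cases "i < k - 1")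
    case True
    then show ?thesis using label[of i] by (auto simp: separators_def)
  next
    case False
    then show ?thesis using \<open>A0 \<in> \<A>\<close> by (simp add: a_def)
  qed
  moreover have in_pts: "x i \<in> {1..k}" if "i < k" for i
    using bij that by (auto dest: bij_betwE)
  moreover have x_neq: "x i \<noteq> x j" if "i < j" "j < k" for i j
    using bij that by (auto simp: bij_betw_def inj_on_def)
  moreover have "labelled_path \<A> x a (k - 1)"
  proof
    fix i assume "i < k - 1"
    then show "separators \<A> (x i) (x (Suc i)) = {a i}" by (rule label)
  next
    fix i j assume "i < j" "j \<le> k - 1"
    then show "separators \<A> (x i) (x j) \<noteq> {}"
      using sep[of "x i" "x j"] in_pts x_neq[of i j] \<open>1 \<le> k\<close> by auto
  next
    fix i j l m assume "i < j" "j < l" "l < m" "m \<le> k - 1"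
    then have "i < k" "j < k" "l < k" "m < k" "i < l" "i < m" "j < m" using \<open>1 \<le> k\<close> by auto
    then show "separators \<A> (x i) (x j) \<inter> separators \<A> (x l) (x m) \<noteq> {} \<or>
      \<not> separators \<A> (x j) (x l) \<subseteq> separators \<A> (x i) (x j) \<union> separators \<A> (x l) (x m)"
      using four_points[OF fam, of "x i" "x j" "x l" "x m"] in_pts x_neq \<open>i < j\<close> \<open>j < l\<close> \<open>l < m\<close>
      by simp
  qed
  ultimately show thesis using that bij by blast
qed

text \<open>
  The labels of one period are distinct members of the family, so the period \<open>m\<close> satisfies
  \<open>k \<le> 2 * m \<le> 2 * card \<A>\<close>. The assumed upper bound on \<open>card \<A>\<close> forces equality up to rounding, and
  then \<open>a 0, \<dots>, a (m - 1)\<close> are all members of the family.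
\<close>
lemma connected_splitting_small:
  assumes fam: "le_splitting_family 4 k \<A>" and conn: "connected_family k \<A>" and "1 \<le> k"
    and small: "card \<A> \<le> (k + 1) div 2"
  obtains n x a where "k \<le> 2 * n" "2 * n \<le> k + 1" "card \<A> = n"
    "bij_betw x {..<k} {1..k}" "bij_betw a {..<n} \<A>"
    "\<And>j. j < k \<Longrightarrow> separators \<A> (x 0) (x j) = a ` {s. s < n \<and> s < j \<and> j \<le> s + n}"
proof -
  have fin: "finite \<A>"
    using fam unfolding le_splitting_family_def by (meson finite_Pow_iff finite_atLeastAtMost finite_subset)
  obtain x a where x: "bij_betw x {..<k} {1..k}" and path: "labelled_path \<A> x a (k - 1)"
    and a: "range a \<subseteq> \<A>"
    using connected_splitting_path[OF fam conn \<open>1 \<le> k\<close>] .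
  interpret labelled_path \<A> x a "k - 1" by fact
  obtain m where m: "0 < m" "inj_on a {..<m}" "\<And>t. m + t < k - 1 \<Longrightarrow> a (m + t) = a t"
  proof (cases "k = 1")
    case True
    then show thesis using that[of 1] by (simp add: lessThan_Suc)
  next
    case False
    then have "0 < k - 1" using \<open>1 \<le> k\<close> by simp
    show thesis by (rule labels_periodic[OF \<open>0 < k - 1\<close> that])
  qed
  have "k \<le> 2 * m" using length_less_double_period[OF m(2,3,1)] by simp
  moreover have "m \<le> card \<A>"
    using card_inj_on_le[OF m(2) _ fin] a by auto
  ultimately have "card \<A> = m" "2 * m \<le> k + 1" using small by auto
  have "bij_betw a {..<m} \<A>"
    using m(2) a fin \<open>card \<A> = m\<close> by (simp add: bij_betw_def card_image card_subset_eq image_subset_iff)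
  moreover have "separators \<A> (x 0) (x j) = a ` {s. s < m \<and> s < j \<and> j \<le> s + m}" if "j < k" for j
    using separators_from_start[OF m(2,3), of j] that \<open>k \<le> 2 * m\<close> by simp
  ultimately show thesis
    using that[of m x a] x \<open>k \<le> 2 * m\<close> \<open>card \<A> = m\<close> \<open>2 * m \<le> k + 1\<close> by blast
qed

text \<open>
  All windows of the standard family contain the point \<open>n\<close>, which corresponds to
  \<open>x (n - 1)\<close>. Complementing the members that miss \<open>x (n - 1)\<close> thus turns \<open>a s\<close> into a window:
  its membership changes after the path positions \<open>s\<close> and \<open>s + n\<close>, so that it
  starts at the point \<open>s + 2\<close>, or at 1 for the last label \<open>s = n - 1\<close>.
\<close>
lemma equivalent_standard:
  assumes sub: "\<A> \<subseteq> Pow {1..k}" and "1 \<le> k" and n: "k \<le> 2 * n" "2 * n \<le> k + 1"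
    and x: "bij_betw x {..<k} {1..k}" and a: "bij_betw a {..<n} \<A>"
    and sep: "\<And>j. j < k \<Longrightarrow> separators \<A> (x 0) (x j) = a ` {s. s < n \<and> s < j \<and> j \<le> s + n}"
  shows "equivalent_families k \<A> (standard_splitting_family (2 * n))"
proof -
  \<comment> \<open>Path positions start at 0, points at 1.\<close>
  define \<sigma> where "\<sigma> i = (if i \<in> {1..k} then x (i - 1) else i)" for i
  have "bij_betw (\<lambda>i. i - 1) {1..k} {..<k}"
    by (rule bij_betw_byWitness[where f' = Suc]) auto
  then have "bij_betw (x \<circ> (\<lambda>i. i - 1)) {1..k} {1..k}" using x by (rule bij_betw_trans)
  then have "bij_betw \<sigma> {1..k} {1..k}"
    by (rule iffD1[OF bij_betw_cong, rotated]) (simp add: \<sigma>_def)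
  then have \<sigma>: "\<sigma> permutes {1..k}" by (rule bij_imp_permutes) (auto simp: \<sigma>_def)
  define \<C> where "\<C> = {A \<in> \<A>. x (n - 1) \<notin> A}"
  define g where "g s = (if s = n - 1 then 1 else s + 2)" for s :: nat
  let ?w = "\<lambda>i. {i..i + n - 1}"
  let ?norm = "\<lambda>A. if A \<in> \<C> then {1..k} - A else A"
  have "1 \<le> n" "n \<le> k" using n \<open>1 \<le> k\<close> by auto
  have mem: "(x 0 \<in> a s) \<noteq> (x j \<in> a s) \<longleftrightarrow> s < j \<and> j \<le> s + n" if "s < n" "j < k" for s j
  proof -
    have "a s \<in> \<A>" using a \<open>s < n\<close> by (auto dest: bij_betwE)
    then have "(x 0 \<in> a s) \<noteq> (x j \<in> a s) \<longleftrightarrow> a s \<in> separators \<A> (x 0) (x j)"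
      by (simp add: separators_def)
    also have "\<dots> \<longleftrightarrow> s < j \<and> j \<le> s + n"
    proof -
      have "inj_on a {..<n}" using a by (simp add: bij_betw_def)
      then have "a s \<in> a ` {s. s < n \<and> s < j \<and> j \<le> s + n} \<longleftrightarrow> s \<in> {s. s < n \<and> s < j \<and> j \<le> s + n}"
        by (rule inj_on_image_mem_iff) (use \<open>s < n\<close> in auto)
      then show ?thesis unfolding sep[OF \<open>j < k\<close>] using \<open>s < n\<close> by simp
    qed
    finally show ?thesis .
  qed
  have norm: "?norm (a s) = \<sigma> ` ?w (g s)" if "s < n" for s
  proof -
    have as: "a s \<in> \<A>" using a \<open>s < n\<close> by (auto dest: bij_betwE)
    have mem_iff: "\<sigma> i \<in> ?norm (a s) \<longleftrightarrow> i \<in> ?w (g s)" if i: "i \<in> {1..k}" for i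
    proof -
      have "\<sigma> i = x (i - 1)" using i by (simp add: \<sigma>_def)
      moreover have "x (i - 1) \<in> {1..k}" using x i by (auto dest: bij_betwE)
      ultimately have "\<sigma> i \<in> ?norm (a s) \<longleftrightarrow> (x (i - 1) \<in> a s \<longleftrightarrow> x (n - 1) \<in> a s)"
        using as by (auto simp: \<C>_def)
      also have "\<dots> \<longleftrightarrow> (s < i - 1 \<and> i - 1 \<le> s + n \<longleftrightarrow> s < n - 1 \<and> n - 1 \<le> s + n)"
        using mem[OF \<open>s < n\<close>, of "i - 1"] mem[OF \<open>s < n\<close>, of "n - 1"] i \<open>n \<le> k\<close> \<open>1 \<le> n\<close> by auto
      also have "\<dots> \<longleftrightarrow> i \<in> ?w (g s)"
        using i n \<open>s < n\<close> by (auto simp: g_def)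
      finally show ?thesis .
    qed
    have onto: "\<sigma> ` {1..k} = {1..k}" using \<sigma> by (rule permutes_image)
    show ?thesis
    proof (intro subset_antisym subsetI)
      fix y assume y: "y \<in> ?norm (a s)"
      moreover have "a s \<subseteq> {1..k}" using sub as by blast
      ultimately have "y \<in> \<sigma> ` {1..k}" unfolding onto by (auto split: if_splits)
      then obtain i where "i \<in> {1..k}" "y = \<sigma> i" by blast
      then show "y \<in> \<sigma> ` ?w (g s)" using mem_iff y by blast
    next
      fix y assume "y \<in> \<sigma> ` ?w (g s)"
      then obtain i where i: "i \<in> ?w (g s)" "y = \<sigma> i" by blast
      moreover have "i \<in> {1..k}" using i(1) n \<open>s < n\<close> by (auto simp: g_def split: if_splits)
      ultimately show "y \<in> ?norm (a s)" using mem_iff by blast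
    qed
  qed
  have "g ` {..<n} = {1..n}"
  proof
    show "g ` {..<n} \<subseteq> {1..n}" by (auto simp: g_def)
    show "{1..n} \<subseteq> g ` {..<n}"
    proof
      fix i assume i: "i \<in> {1..n}"
      then have "i = g (if i = 1 then n - 1 else i - 2)" by (auto simp: g_def)
      moreover have "(if i = 1 then n - 1 else i - 2) \<in> {..<n}" using i by auto
      ultimately show "i \<in> g ` {..<n}" by (rule image_eqI)
    qed
  qed
  have "(\<lambda>A. inv \<sigma> ` ?norm A) ` \<A> = (\<lambda>s. inv \<sigma> ` ?norm (a s)) ` {..<n}"
    unfolding bij_betw_imp_surj_on[OF a, symmetric] image_image ..
  also have "\<dots> = (\<lambda>s. ?w (g s)) ` {..<n}"
  proof (rule image_cong)
    fix s assume "s \<in> {..<n}"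
    then have "inv \<sigma> ` ?norm (a s) = inv \<sigma> ` \<sigma> ` ?w (g s)" using norm by simp
    also have "\<dots> = ?w (g s)" using permutes_inj[OF \<sigma>] by (simp add: image_inv_f_f)
    finally show "inv \<sigma> ` ?norm (a s) = ?w (g s)" .
  qed simp
  also have "\<dots> = ?w ` g ` {..<n}" by (simp add: image_image)
  also have "\<dots> = standard_splitting_family (2 * n)"
    unfolding \<open>g ` {..<n} = {1..n}\<close> standard_splitting_family_double ..
  finally have "standard_splitting_family (2 * n) = (\<lambda>A. inv \<sigma> ` ?norm A) ` \<A>" ..
  moreover have "\<C> \<subseteq> \<A>" by (auto simp: \<C>_def)
  ultimately show ?thesis
    unfolding equivalent_families_def using permutes_inv[OF \<sigma>] by blast
qed

theorem theorem2p3: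
  fixes k :: nat and \<A> :: "nat set set"
  assumes "k \<ge> 1"
    and "le_splitting_family 4 k \<A>"
    and "connected_family k \<A>"
    and "\<And>\<B>. le_splitting_family 4 k \<B> \<Longrightarrow> connected_family k \<B> \<Longrightarrow> card \<A> \<le> card \<B>"
  shows "(even k \<longrightarrow> equivalent_families k \<A> (standard_splitting_family k)) \<and>
         (odd k \<longrightarrow> equivalent_families k \<A>
                      ((\<lambda>A. A \<inter> {1..k}) ` standard_splitting_family (k + 1))) \<and>
         int (card \<A>) = \<lceil>real k / 2\<rceil>"
proof -
  define h where "h = (k + 1) div 2"
  have h: "1 \<le> h" "k \<le> 2 * h" "2 * h - 1 \<le> k" using \<open>k \<ge> 1\<close> by (auto simp: h_def)
  have std: "le_splitting_family 4 k (standard_splitting_family (2 * h))"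
    using standard_le_splitting h by simp
  have "card \<A> \<le> h"
    using assms(4)[OF std standard_connected] h \<open>k \<ge> 1\<close> by (simp add: card_standard_splitting_family)
  obtain n x a where n: "k \<le> 2 * n" "2 * n \<le> k + 1" "card \<A> = n"
    and xa: "bij_betw x {..<k} {1..k}" "bij_betw a {..<n} \<A>"
    "\<And>j. j < k \<Longrightarrow> separators \<A> (x 0) (x j) = a ` {s. s < n \<and> s < j \<and> j \<le> s + n}"
    by (rule connected_splitting_small[OF assms(2,3,1) \<open>card \<A> \<le> h\<close>[unfolded h_def] that])
  have "\<A> \<subseteq> Pow {1..k}" using assms(2) by (simp add: le_splitting_family_def)
  then have eq: "equivalent_families k \<A> (standard_splitting_family (2 * n))"
    by (rule equivalent_standard[OF _ assms(1) n(1,2) xa])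
  have "A \<inter> {1..k} = A" if "A \<in> standard_splitting_family (2 * n)" for A
    using that n unfolding standard_splitting_family_double by auto
  then have "(\<lambda>A. A \<inter> {1..k}) ` standard_splitting_family (2 * n) = standard_splitting_family (2 * n)"
    by simp
  moreover have "even k \<Longrightarrow> k = 2 * n" "odd k \<Longrightarrow> k + 1 = 2 * n" using n(1,2) by presburger+
  moreover have "int n = \<lceil>real k / 2\<rceil>"
    using n(1,2) by (intro ceiling_unique[symmetric]) auto
  ultimately show ?thesis using eq n(3) by auto
qed

end
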